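(* Let $\mathcal{K}=(K,\Gamma,\boldsymbol{k};v,\pi)$ be a valued difference field of residue characteristic zero. If $\mathcal{K}$ is $\sigma$-henselian, then $\mathcal{K}$ satisfies Axiom 2, that is: for all $n$ and all $\alpha_0,\dots,\alpha_n\in\boldsymbol{k}$ not all $0$, the equation $1+\alpha_0x+\alpha_1\bar\sigma(x)+\dots+\alpha_n\bar\sigma^n(x)=0$ has a solution in $\boldsymbol{k}$.
   Context: A valued difference field $(K,\Gamma,\boldsymbol{k};v,\pi)$ is a field $K$ with a surjective valuation $v:K^\times\to\Gamma$ (and $v(0)=\infty$), valuation ring $\mathcal{O}$, residue map $\pi:\mathcal{O}\to\boldsymbol{k}$ onto the residue field, and a field automorphism $\sigma$ of $K$ with $\sigma(\mathcal{O})=\mathcal{O}$. Then $\sigma$ induces an automorphism $\bar\sigma$ of $\boldsymbol{k}$, and an order-preserving automorphism of $\Gamma$, also denoted $\sigma$, by $\sigma(v(a))=v(\sigma(a))$. For $\boldsymbol{i}=(i_0,\dots,i_n)\in\mathbb{N}^{n+1}$ put $\boldsymbol{\sigma}(x)^{\boldsymbol{i}}=\prod_k\sigma^k(x)^{i_k}$, $\boldsymbol{\sigma}^{\boldsymbol{i}}(\gamma)=\sum_k i_k\sigma^k(\gamma)$ for $\gamma\in\Gamma$, and $|\boldsymbol{i}|=\sum_k i_k$. A $\sigma$-polynomial over $K$ of order $\le n$ is a finite sum $G(x)=\sum_{\boldsymbol{i}}a_{\boldsymbol{i}}\boldsymbol{\sigma}(x)^{\boldsymbol{i}}$ with $a_{\boldsymbol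 i}\in K$. The $\sigma$-polynomials $G_{(\boldsymbol{i})}$ are defined by the formal Taylor expansion $G(a+x)=\sum_{\boldsymbol{i}}G_{(\boldsymbol{i})}(a)\boldsymbol{\sigma}(x)^{\boldsymbol{i}}$. For $G$ of order $\le n$ and $a\in K$, with multi-indices ranging over $\mathbb{N}^{n+1}$, $(G,a)$ is in $\sigma$-hensel configuration if $G\notin K$ and there are $\boldsymbol{i}$ with $|\boldsymbol{i}|=1$ and $\gamma\in\Gamma$ such that (i) $v(G(a))=v(G_{(\boldsymbol{i})}(a))+\boldsymbol{\sigma}^{\boldsymbol{i}}\gamma\le v(G_{(\boldsymbol{j})}(a))+\boldsymbol{\sigma}^{\boldsymbol{j}}\gamma$ whenever $|\boldsymbol{j}|=1$; and (ii) $v(G_{(\boldsymbol{j})}(a))+\boldsymbol{\sigma}^{\boldsymbol{j}}\gamma<v(G_{(\boldsymbol{j}+\boldsymbol{l})}(a))+\boldsymbol{\sigma}^{\boldsymbol{j}+\boldsymbol{l}}\gamma$ whenever $\boldsymbol{j},\boldsymbol{l}\ne0$ and $G_{(\boldsymbol{j})}\ne0$. Such $\gamma$ is unique and denoted $\gamma(G,a)$. $\mathcal{K}$ is $\sigma$-henselian if for every $(G,a)$ in $\sigma$-hensel configuration there is $b\in K$ with $v(b-a)=\gamma(G,a)$ and $G(b)=0$. *)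

theory Defs
  imports Complex_Main "HOL-Library.Extended" "HOL-Library.Poly_Mapping"
begin

section \<open>Valued difference fields\<close>

text \<open>
  A valuation is a map \<open>K\<^sup>\<times> \<rightarrow> \<Gamma>\<close>. It is represented by a total function \<open>v\<close> whose value at \<open>0\<close> is
  never used: every comparison goes through \<open>val v\<close>, which sends \<open>0\<close> to \<open>\<infinity>\<close>. The element \<open>Minf\<close>
  of the type \<open>extended\<close> does not occur as a value.
\<close>

definition val :: "('k::field \<Rightarrow> 'g::linordered_ab_group_add) \<Rightarrow> 'k \<Rightarrow> 'g extended" where
  "val v x = (if x = 0 then Pinf else Fin (v x))"

definition valuation_ring :: "('k::field \<Rightarrow> 'g::linordered_ab_group_add) \<Rightarrow> 'k set" where
  "valuation_ring v = {x. 0 \<le> val v x}"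

text \<open>
  Likewise \<open>\<pi>\<close> is only relevant on the valuation ring. The condition on its kernel says that \<open>\<pi>\<close>
  identifies \<open>'r\<close> with the quotient of the valuation ring by its maximal ideal.
\<close>

locale valued_difference_field =
  fixes v :: "'k::field \<Rightarrow> 'g::linordered_ab_group_add"
    and \<pi> :: "'k \<Rightarrow> 'r::field"
    and \<sigma> :: "'k \<Rightarrow> 'k"
  assumes v_mult: "\<And>x y. x \<noteq> 0 \<Longrightarrow> y \<noteq> 0 \<Longrightarrow> v (x * y) = v x + v y"
    and v_add: "\<And>x y. x \<noteq> 0 \<Longrightarrow> y \<noteq> 0 \<Longrightarrow> x + y \<noteq> 0 \<Longrightarrow> min (v x) (v y) \<le> v (x + y)"
    and v_surj: "v ` (UNIV - {0}) = UNIV"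
    and res_one: "\<pi> 1 = 1"
    and res_add: "\<And>x y. x \<in> valuation_ring v \<Longrightarrow> y \<in> valuation_ring v \<Longrightarrow> \<pi> (x + y) = \<pi> x + \<pi> y"
    and res_mult: "\<And>x y. x \<in> valuation_ring v \<Longrightarrow> y \<in> valuation_ring v \<Longrightarrow> \<pi> (x * y) = \<pi> x * \<pi> y"
    and res_surj: "\<pi> ` valuation_ring v = UNIV"
    and res_ker: "\<And>x. x \<in> valuation_ring v \<Longrightarrow> \<pi> x = 0 \<longleftrightarrow> 0 < val v x"
    and aut_bij: "bij \<sigma>"
    and aut_add: "\<And>x y. \<sigma> (x + y) = \<sigma> x + \<sigma> y"
    and aut_mult: "\<And>x y. \<sigma> (x * y) = \<sigma> x * \<sigma> y"
    and aut_ring: "\<sigma> ` valuation_ring v = valuation_ring v"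

definition induced_res ::
  "('k::field \<Rightarrow> 'g::linordered_ab_group_add) \<Rightarrow> ('k \<Rightarrow> 'r::field) \<Rightarrow> ('k \<Rightarrow> 'k) \<Rightarrow> 'r \<Rightarrow> 'r" where
  "induced_res v \<pi> \<sigma> \<alpha> = (THE \<beta>. \<exists>a\<in>valuation_ring v. \<pi> a = \<alpha> \<and> \<beta> = \<pi> (\<sigma> a))"

definition induced_vg ::
  "('k::field \<Rightarrow> 'g::linordered_ab_group_add) \<Rightarrow> ('k \<Rightarrow> 'k) \<Rightarrow> 'g \<Rightarrow> 'g" where
  "induced_vg v \<sigma> \<gamma> = (THE \<delta>. \<exists>a. a \<noteq> 0 \<and> v a = \<gamma> \<and> \<delta> = v (\<sigma> a))"

context valued_difference_field
begin

lemma aut_zero [simp]: "\<sigma> 0 = 0"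
  using aut_add[of 0 0] by (simp only: add_0_right add_cancel_right_right)

lemma aut_eq_0_iff [simp]: "\<sigma> x = 0 \<longleftrightarrow> x = 0"
  using aut_bij aut_zero by (metis bij_pointE)

lemma aut_minus: "\<sigma> (- x) = - \<sigma> x"
  using aut_add[of x "- x"] by (simp add: eq_neg_iff_add_eq_0 add.commute)

lemma aut_mem_iff: "\<sigma> x \<in> valuation_ring v \<longleftrightarrow> x \<in> valuation_ring v"
  using aut_bij aut_ring by (metis bij_is_inj inj_image_mem_iff)

lemma mem_valuation_ring: "x \<noteq> 0 \<Longrightarrow> x \<in> valuation_ring v \<longleftrightarrow> 0 \<le> v x"
  by (simp add: valuation_ring_def val_def zero_extended_def)

lemma v_le_iff:
  assumes "x \<noteq> 0" "y \<noteq> 0"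
  shows "v x \<le> v y \<longleftrightarrow> y / x \<in> valuation_ring v"
proof -
  have "v y = v x + v (y / x)"
    using v_mult[of x "y / x"] assms by simp
  moreover have "y / x \<in> valuation_ring v \<longleftrightarrow> 0 \<le> v (y / x)"
    using assms by (intro mem_valuation_ring) simp
  ultimately show ?thesis by simp
qed

lemma aut_divide: "y \<noteq> 0 \<Longrightarrow> \<sigma> (x / y) = \<sigma> x / \<sigma> y"
  using aut_mult[of "x / y" y] by (simp add: field_simps)

lemma v_aut_le_iff:
  assumes "x \<noteq> 0" "y \<noteq> 0"
  shows "v (\<sigma> x) \<le> v (\<sigma> y) \<longleftrightarrow> v x \<le> v y"
  using assms v_le_iff[of x y] v_le_iff[of "\<sigma> x" "\<sigma> y"] aut_divide[of x y] aut_mem_iff[of "y / x"]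
  by simp

lemma induced_vg_v:
  assumes "a \<noteq> 0"
  shows "induced_vg v \<sigma> (v a) = v (\<sigma> a)"
  unfolding induced_vg_def
proof (rule the_equality)
  fix \<delta> assume "\<exists>b. b \<noteq> 0 \<and> v b = v a \<and> \<delta> = v (\<sigma> b)"
  then show "\<delta> = v (\<sigma> a)"
    using assms v_aut_le_iff by (metis order_antisym order_refl)
qed (use assms in blast)

lemma induced_vg_strict_mono: "strict_mono (induced_vg v \<sigma>)"
proof (rule strict_monoI)
  fix \<gamma> \<delta> :: 'g assume "\<gamma> < \<delta>"
  moreover obtain a where "a \<noteq> 0" "v a = \<gamma>"
    using v_surj by (metis Diff_iff UNIV_I imageE singletonI)
  moreover obtain b where "b \<noteq> 0" "v b = \<delta>"
    using v_surj by (metis Diff_iff UNIV_I imageE singletonI)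
  ultimately show "induced_vg v \<sigma> \<gamma> < induced_vg v \<sigma> \<delta>"
    using induced_vg_v v_aut_le_iff[of b a] by (auto simp: not_le[symmetric])
qed

lemma v_neg: "x \<noteq> 0 \<Longrightarrow> v (- x) = v x"
proof -
  assume "x \<noteq> 0"
  have "v 1 = 0"
    using v_mult[of 1 1] by simp
  then have "v (- 1) + v (- 1) = 0"
    using v_mult[of "- 1" "- 1"] by simp
  then have "v (- 1) = 0" by (simp add: double_zero)
  then show ?thesis
    using v_mult[of "- 1" x] \<open>x \<noteq> 0\<close> by simp
qed

lemma valuation_ring_minus: "x \<in> valuation_ring v \<Longrightarrow> - x \<in> valuation_ring v"
  using v_neg by (cases "x = 0") (auto simp: mem_valuation_ring)

lemma valuation_ring_diff:
  assumes "x \<in> valuation_ring v" "y \<in> valuation_ring v"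
  shows "x - y \<in> valuation_ring v"
proof -
  have "x + z \<in> valuation_ring v" if "z \<in> valuation_ring v" for z
  proof (cases "x = 0 \<or> z = 0 \<or> x + z = 0")
    case True
    then show ?thesis
      using assms that by (auto simp: valuation_ring_def val_def)
  next
    case False
    then show ?thesis
      using assms that v_add[of x z] mem_valuation_ring[of x] mem_valuation_ring[of z]
        mem_valuation_ring[of "x + z"] by (auto simp: min_def split: if_splits)
  qed
  then show ?thesis
    using valuation_ring_minus[OF assms(2)] by (metis uminus_add_conv_diff add.commute)
qed

lemma res_diff:
  assumes "x \<in> valuation_ring v" "y \<in> valuation_ring v"
  shows "\<pi> (x - y) = \<pi> x - \<pi> y"
  using res_add[OF valuation_ring_diff[OF assms] assms(2)] by (simp add: algebra_simps)

lemma pos_val_aut: "0 < val v x \<Longrightarrow> 0 < val v (\<sigma> x)"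
proof (cases "x = 0")
  case False
  assume "0 < val v x"
  then have "v 1 < v x"
    using False v_mult[of 1 1] by (simp add: val_def zero_extended_def)
  then have "v (\<sigma> 1) < v (\<sigma> x)"
    using False v_aut_le_iff[of x 1] by (simp add: not_le[symmetric])
  moreover have "\<sigma> 1 = 1"
    using aut_mult[of 1 1] aut_eq_0_iff[of 1] by simp
  ultimately show ?thesis
    using False v_mult[of 1 1] by (simp add: val_def zero_extended_def)
qed simp

lemma induced_res_res:
  assumes "a \<in> valuation_ring v"
  shows "induced_res v \<pi> \<sigma> (\<pi> a) = \<pi> (\<sigma> a)"
  unfolding induced_res_def
proof (rule the_equality)
  fix \<beta> assume "\<exists>b\<in>valuation_ring v. \<pi> b = \<pi> a \<and> \<beta> = \<pi> (\<sigma> b)"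
  then obtain b where b: "b \<in> valuation_ring v" "\<pi> b = \<pi> a" "\<beta> = \<pi> (\<sigma> b)" by blast
  have "b - a \<in> valuation_ring v" "\<pi> (b - a) = 0"
    using b assms valuation_ring_diff res_diff by auto
  then have "\<pi> (\<sigma> (b - a)) = 0"
    using res_ker pos_val_aut aut_mem_iff by blast
  moreover have "\<sigma> (b - a) = \<sigma> b - \<sigma> a"
    using aut_add[of b "- a"] aut_minus by simp
  ultimately show "\<beta> = \<pi> (\<sigma> a)"
    using b assms res_diff aut_mem_iff by simp
qed (use assms in blast)

end


section \<open>Difference polynomials\<close>

text \<open>
  A multi-index is a finitely supported function \<open>i\<close>, with \<open>lookup i k\<close> in the role of \<open>i\<^sub>k\<close>; the
  set \<open>\<nat>\<^sup>n\<^sup>+\<^sup>1\<close> corresponds to the indices supported in \<open>{..n}\<close>. A difference polynomial is a formal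
  object, namely a polynomial in the variables \<open>x, \<sigma>(x), \<sigma>\<^sup>2(x), \<dots>\<close>; \<open>lookup G i\<close> is the coefficient
  of \<open>\<sigma>(x)\<^sup>i\<close>, and the ring structure is the one of \<open>Poly_Mapping\<close>.
\<close>

type_synonym multi_index = "nat \<Rightarrow>\<^sub>0 nat"
type_synonym 'k sigma_poly = "multi_index \<Rightarrow>\<^sub>0 'k"

definition multi_indices :: "nat \<Rightarrow> multi_index set" where
  "multi_indices n = {i. Poly_Mapping.keys i \<subseteq> {..n}}"

definition weight :: "multi_index \<Rightarrow> nat" where
  "weight i = (\<Sum>k\<in>Poly_Mapping.keys i. Poly_Mapping.lookup i k)"

definition sigma_monom :: "('k::field \<Rightarrow> 'k) \<Rightarrow> multi_index \<Rightarrow> 'k \<Rightarrow> 'k" where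
  "sigma_monom \<sigma> i x = (\<Prod>k\<in>Poly_Mapping.keys i. (\<sigma> ^^ k) x ^ Poly_Mapping.lookup i k)"

text \<open>The inner sum is the \<open>i\<^sub>k\<close>-fold multiple of \<open>\<sigma>\<^sup>k(\<gamma>)\<close> in the ordered group.\<close>

definition sigma_weight ::
  "('k::field \<Rightarrow> 'g::linordered_ab_group_add) \<Rightarrow> ('k \<Rightarrow> 'k) \<Rightarrow> multi_index \<Rightarrow> 'g \<Rightarrow> 'g" where
  "sigma_weight v \<sigma> i \<gamma> =
     (\<Sum>k\<in>Poly_Mapping.keys i. \<Sum>_<Poly_Mapping.lookup i k. (induced_vg v \<sigma> ^^ k) \<gamma>)"

definition order_le :: "nat \<Rightarrow> 'k::field sigma_poly \<Rightarrow> bool" where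
  "order_le n G \<longleftrightarrow> Poly_Mapping.keys G \<subseteq> multi_indices n"

definition sigma_eval :: "('k::field \<Rightarrow> 'k) \<Rightarrow> 'k sigma_poly \<Rightarrow> 'k \<Rightarrow> 'k" where
  "sigma_eval \<sigma> G x = (\<Sum>i\<in>Poly_Mapping.keys G. Poly_Mapping.lookup G i * sigma_monom \<sigma> i x)"

text \<open>
  The Taylor expansion is taken formally. In the ring of polynomials in the variables
  \<open>\<sigma>\<^sup>k(x)\<close> whose coefficients are difference polynomials in \<open>a\<close>, \<open>taylor_var k\<close> is
  \<open>\<sigma>\<^sup>k(a + x) = \<sigma>\<^sup>k(a) + \<sigma>\<^sup>k(x)\<close> and \<open>taylor G\<close> is \<open>G(a + x)\<close>; the difference polynomial
  \<open>G\<^sub>(\<^sub>i\<^sub>)\<close> is the coefficient of \<open>\<sigma>(x)\<^sup>i\<close> in it.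
\<close>

definition taylor_var :: "nat \<Rightarrow> multi_index \<Rightarrow>\<^sub>0 'k::field sigma_poly" where
  "taylor_var k =
     Poly_Mapping.single 0 (Poly_Mapping.single (Poly_Mapping.single k 1) 1)
     + Poly_Mapping.single (Poly_Mapping.single k 1) 1"

definition taylor :: "'k::field sigma_poly \<Rightarrow> multi_index \<Rightarrow>\<^sub>0 'k sigma_poly" where
  "taylor G = (\<Sum>i\<in>Poly_Mapping.keys G.
     Poly_Mapping.single 0 (Poly_Mapping.single 0 (Poly_Mapping.lookup G i))
     * (\<Prod>k\<in>Poly_Mapping.keys i. taylor_var k ^ Poly_Mapping.lookup i k))"

definition taylor_coeff :: "'k::field sigma_poly \<Rightarrow> multi_index \<Rightarrow> 'k sigma_poly" where
  "taylor_coeff G i = Poly_Mapping.lookup (taylor G) i"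


section \<open>Sigma-hensel configurations\<close>

definition hensel_witness ::
  "('k::field \<Rightarrow> 'g::linordered_ab_group_add) \<Rightarrow> ('k \<Rightarrow> 'k) \<Rightarrow> nat \<Rightarrow> 'k sigma_poly \<Rightarrow> 'k
   \<Rightarrow> multi_index \<Rightarrow> 'g \<Rightarrow> bool" where
  "hensel_witness v \<sigma> n G a i \<gamma> \<longleftrightarrow>
     val v (sigma_eval \<sigma> G a) =
       val v (sigma_eval \<sigma> (taylor_coeff G i) a) + Fin (sigma_weight v \<sigma> i \<gamma>) \<and>
     (\<forall>j\<in>multi_indices n. weight j = 1 \<longrightarrow>
        val v (sigma_eval \<sigma> (taylor_coeff G i) a) + Fin (sigma_weight v \<sigma> i \<gamma>)
        \<le> val v (sigma_eval \<sigma> (taylor_coeff G j) a) + Fin (sigma_weight v \<sigma> j \<gamma>)) \<and>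
     (\<forall>j\<in>multi_indices n. \<forall>l\<in>multi_indices n.
        j \<noteq> 0 \<longrightarrow> l \<noteq> 0 \<longrightarrow> taylor_coeff G j \<noteq> 0 \<longrightarrow>
        val v (sigma_eval \<sigma> (taylor_coeff G j) a) + Fin (sigma_weight v \<sigma> j \<gamma>)
        < val v (sigma_eval \<sigma> (taylor_coeff G (j + l)) a) + Fin (sigma_weight v \<sigma> (j + l) \<gamma>))"

definition hensel_config ::
  "('k::field \<Rightarrow> 'g::linordered_ab_group_add) \<Rightarrow> ('k \<Rightarrow> 'k) \<Rightarrow> nat \<Rightarrow> 'k sigma_poly \<Rightarrow> 'k \<Rightarrow> bool" where
  "hensel_config v \<sigma> n G a \<longleftrightarrow>
     (\<forall>c. G \<noteq> Poly_Mapping.single 0 c) \<and>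
     (\<exists>i\<in>multi_indices n. weight i = 1 \<and> (\<exists>\<gamma>. hensel_witness v \<sigma> n G a i \<gamma>))"

text \<open>
  Well-defined for configurations when \<open>K\<close> has characteristic zero: see the lemma
  \<open>hensel_gamma_eq\<close> below.
\<close>

definition hensel_gamma ::
  "('k::field \<Rightarrow> 'g::linordered_ab_group_add) \<Rightarrow> ('k \<Rightarrow> 'k) \<Rightarrow> nat \<Rightarrow> 'k sigma_poly \<Rightarrow> 'k \<Rightarrow> 'g" where
  "hensel_gamma v \<sigma> n G a =
     (THE \<gamma>. \<exists>i\<in>multi_indices n. weight i = 1 \<and> hensel_witness v \<sigma> n G a i \<gamma>)"

definition sigma_henselian ::
  "('k::field \<Rightarrow> 'g::linordered_ab_group_add) \<Rightarrow> ('k \<Rightarrow> 'k) \<Rightarrow> bool" where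
  "sigma_henselian v \<sigma> \<longleftrightarrow>
     (\<forall>n G a. order_le n G \<longrightarrow> hensel_config v \<sigma> n G a \<longrightarrow>
        (\<exists>b. val v (b - a) = Fin (hensel_gamma v \<sigma> n G a) \<and> sigma_eval \<sigma> G b = 0))"


section \<open>Uniqueness of gamma\<close>

lemma weight_eq_1_iff: "weight i = 1 \<longleftrightarrow> (\<exists>k. i = Poly_Mapping.single k 1)"
proof
  assume "weight i = 1"
  then obtain k where k: "k \<in> Poly_Mapping.keys i" "Poly_Mapping.lookup i k = 1"
    and z: "\<And>m. m \<in> Poly_Mapping.keys i \<Longrightarrow> m \<noteq> k \<Longrightarrow> Poly_Mapping.lookup i m = 0"
    unfolding weight_def by (subst (asm) sum_eq_1_iff) auto
  have "i = Poly_Mapping.single k 1"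
    using k z by (intro poly_mapping_eqI) (auto simp: lookup_single when_def in_keys_iff)
  then show "\<exists>k. i = Poly_Mapping.single k 1" ..
qed (auto simp: weight_def)

lemma lookup_const_mult:
  "Poly_Mapping.lookup (Poly_Mapping.single 0 c * p) i = c * Poly_Mapping.lookup p (i::multi_index)"
  for p :: "multi_index \<Rightarrow>\<^sub>0 'a::comm_semiring_1"
  by (simp add: mult_map_scale_conv_mult[symmetric] Poly_Mapping.map.rep_eq when_def)

lemma lookup_mult_monom:
  "Poly_Mapping.lookup (p * Poly_Mapping.single m 1) i =
     (if \<exists>j. i = j + m then Poly_Mapping.lookup p (i - m) else 0)"
  for p :: "multi_index \<Rightarrow>\<^sub>0 'a::comm_semiring_1"
proof -
  have "Sum_any (\<lambda>r. (Poly_Mapping.lookup (Poly_Mapping.single m (1::'a)) r when i = q + r)) = (1 when i = q + m)" for q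
  proof -
    have "(\<lambda>r. (Poly_Mapping.lookup (Poly_Mapping.single m (1::'a)) r when i = q + r)) =
        (\<lambda>r. (1 when i = q + m) when r = m)"
      by (auto simp: fun_eq_iff lookup_single when_def)
    then show ?thesis by (simp only: Sum_any_when_equal)
  qed
  then have "Poly_Mapping.lookup (p * Poly_Mapping.single m 1) i =
      Sum_any (\<lambda>q. Poly_Mapping.lookup p q * (1 when i = q + m))"
    by (simp add: lookup_mult)
  also have "\<dots> = (if \<exists>j. i = j + m then Poly_Mapping.lookup p (i - m) else 0)"
  proof (cases "\<exists>j. i = j + m")
    case True
    then obtain j where "i = j + m" ..
    then show ?thesis by (simp add: mult_when)
  next
    case False
    then show ?thesis by (auto simp: when_def)
  qed
  finally show ?thesis .
qed

definition taylor_monom :: "multi_index \<Rightarrow> multi_index \<Rightarrow>\<^sub>0 'k::field sigma_poly" where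
  "taylor_monom i = (\<Prod>k\<in>Poly_Mapping.keys i. taylor_var k ^ Poly_Mapping.lookup i k)"

lemma taylor_monom_superset:
  "finite A \<Longrightarrow> Poly_Mapping.keys i \<subseteq> A \<Longrightarrow>
   taylor_monom i = (\<Prod>k\<in>A. taylor_var k ^ Poly_Mapping.lookup i k)"
  unfolding taylor_monom_def by (rule prod.mono_neutral_left) (auto simp: in_keys_iff)

lemma taylor_monom_add:
  "taylor_monom (i + Poly_Mapping.single m 1) = taylor_monom i * taylor_var m"
proof -
  let ?A = "insert m (Poly_Mapping.keys i)"
  have "taylor_monom (i + Poly_Mapping.single m 1) =
      (\<Prod>k\<in>?A. taylor_var k ^ Poly_Mapping.lookup (i + Poly_Mapping.single m 1) k)"
    using keys_add[of i "Poly_Mapping.single m 1"]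
    by (intro taylor_monom_superset) (auto split: if_splits)
  also have "\<dots> = (\<Prod>k\<in>?A. taylor_var k ^ Poly_Mapping.lookup i k * (if k = m then taylor_var m else 1))"
    by (intro prod.cong) (auto simp: lookup_add lookup_single when_def power_add)
  also have "\<dots> = (\<Prod>k\<in>?A. taylor_var k ^ Poly_Mapping.lookup i k) * taylor_var m"
    by (subst prod.distrib) (simp add: prod.delta)
  also have "(\<Prod>k\<in>?A. taylor_var k ^ Poly_Mapping.lookup i k) = taylor_monom i"
    by (intro taylor_monom_superset[symmetric]) auto
  finally show ?thesis .
qed

lemma multi_index_induct [case_names zero add]:
  assumes "P 0" and "\<And>i m. P i \<Longrightarrow> P (i + Poly_Mapping.single m 1)"
  shows "P (i :: multi_index)"
proof (induction "weight i" arbitrary: i rule: less_induct)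
  case (less i)
  show ?case
  proof (cases "i = 0")
    case False
    then obtain m where m: "m \<in> Poly_Mapping.keys i" by (metis keys_eq_empty equals0I)
    define j where "j = i - Poly_Mapping.single m 1"
    have i: "i = j + Poly_Mapping.single m 1"
      using m unfolding j_def
      by (intro poly_mapping_eqI) (auto simp: lookup_add lookup_minus lookup_single when_def in_keys_iff)
    have "weight j = (\<Sum>k\<in>Poly_Mapping.keys i. Poly_Mapping.lookup j k)"
      unfolding weight_def
      by (rule sum.mono_neutral_left) (auto simp: in_keys_iff j_def lookup_minus)
    also have "\<dots> < weight i"
      unfolding weight_def using m
      by (intro sum_strict_mono_ex1) (auto simp: in_keys_iff j_def lookup_minus intro!: bexI[of _ m])
    finally show ?thesis
      using less assms(2) i by metis
  qed (use assms in simp)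
qed

lemma lookup_mult_taylor_var:
  "Poly_Mapping.lookup (p * taylor_var m) i =
     Poly_Mapping.lookup p i * Poly_Mapping.single (Poly_Mapping.single m 1) 1 +
     (if \<exists>j. i = j + Poly_Mapping.single m 1 then Poly_Mapping.lookup p (i - Poly_Mapping.single m 1) else 0)"
proof -
  let ?y = "Poly_Mapping.single (Poly_Mapping.single m 1) 1"
  have "p * taylor_var m = Poly_Mapping.single 0 ?y * p + p * Poly_Mapping.single (Poly_Mapping.single m 1) 1"
    unfolding taylor_var_def by (simp only: distrib_left mult.commute[of p "Poly_Mapping.single 0 ?y"])
  then show ?thesis
    by (simp only: lookup_add lookup_mult_monom lookup_const_mult mult.commute[of ?y])
qed

lemma single_ne_0: "(0 :: multi_index) \<noteq> j + Poly_Mapping.single m 1"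
  by (metis add_is_0 lookup_add lookup_single_eq lookup_zero one_neq_zero)

lemma single_eq_add_single_iff:
  "(\<exists>j. Poly_Mapping.single k (1::nat) = j + Poly_Mapping.single m 1) \<longleftrightarrow> k = m"
proof
  assume "\<exists>j. Poly_Mapping.single k (1::nat) = j + Poly_Mapping.single m 1"
  then obtain j where "Poly_Mapping.single k (1::nat) = j + Poly_Mapping.single m 1" ..
  then have "Poly_Mapping.lookup (Poly_Mapping.single k (1::nat)) m \<noteq> 0"
    by (simp only: lookup_add lookup_single_eq)
  then show "k = m" by (simp add: lookup_single when_def split: if_splits)
qed (auto intro: exI[of _ 0])

lemma lookup_taylor_monom_0: "Poly_Mapping.lookup (taylor_monom i) 0 = Poly_Mapping.single i 1"
proof (induction i rule: multi_index_induct)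
  case zero
  show ?case by (simp add: taylor_monom_def)
next
  case (add i m)
  then show ?case
    by (simp add: taylor_monom_add lookup_mult_taylor_var mult_single single_ne_0 del: One_nat_def)
qed

lemma lookup_taylor_monom_1:
  "Poly_Mapping.lookup (taylor_monom i :: multi_index \<Rightarrow>\<^sub>0 'k::field sigma_poly) (Poly_Mapping.single k 1) =
     Poly_Mapping.single (i - Poly_Mapping.single k 1) (of_nat (Poly_Mapping.lookup i k))"
proof (induction i rule: multi_index_induct)
  case zero
  show ?case
    using single_ne_0[of 0 k] by (simp add: taylor_monom_def lookup_one when_def del: One_nat_def)
next
  case (add i m)
  have 1: "Poly_Mapping.single (i - Poly_Mapping.single k 1 + Poly_Mapping.single m 1)
         (of_nat (Poly_Mapping.lookup i k)) =
       Poly_Mapping.single (i + Poly_Mapping.single m 1 - Poly_Mapping.single k 1)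
         (of_nat (Poly_Mapping.lookup i k) :: 'k)"
  proof (cases "Poly_Mapping.lookup i k = 0")
    case False
    then have "i - Poly_Mapping.single k 1 + Poly_Mapping.single m 1 =
        i + Poly_Mapping.single m 1 - Poly_Mapping.single k 1"
      by (intro poly_mapping_eqI) (auto simp: lookup_add lookup_minus lookup_single when_def)
    then show ?thesis by simp
  qed simp
  show ?case
  proof (cases "k = m")
    case True
    then show ?thesis
      using 1 unfolding taylor_monom_add lookup_mult_taylor_var add single_eq_add_single_iff mult_single
      by (simp add: lookup_taylor_monom_0 lookup_add single_add[symmetric] add.commute)
  next
    case False
    then show ?thesis
      using 1 unfolding taylor_monom_add lookup_mult_taylor_var add single_eq_add_single_iff mult_single
      by (simp add: lookup_add lookup_single_not_eq)
  qed
qed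

lemma taylor_coeff_eq:
  "taylor_coeff G i = (\<Sum>j\<in>Poly_Mapping.keys G.
     Poly_Mapping.single 0 (Poly_Mapping.lookup G j) * Poly_Mapping.lookup (taylor_monom j) i)"
  by (simp add: taylor_coeff_def taylor_def taylor_monom_def[symmetric] lookup_sum lookup_const_mult)

lemma exists_taylor_coeff_1_nonzero:
  fixes G :: "'k::field sigma_poly"
  assumes "CHAR('k) = 0" and "order_le n G" and "\<And>c. G \<noteq> Poly_Mapping.single 0 c"
  obtains k where "k \<le> n" "taylor_coeff G (Poly_Mapping.single k 1) \<noteq> 0"
proof -
  have "\<exists>i\<in>Poly_Mapping.keys G. i \<noteq> 0"
  proof (rule ccontr)
    assume "\<not> ?thesis"
    then have "G = Poly_Mapping.single 0 (Poly_Mapping.lookup G 0)"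
      by (intro poly_mapping_eqI) (auto simp: lookup_single when_def in_keys_iff)
    then show False using assms(3) by blast
  qed
  then obtain i where i: "i \<in> Poly_Mapping.keys G" "i \<noteq> 0" by blast
  then obtain k where k: "k \<in> Poly_Mapping.keys i" by (metis keys_eq_empty equals0I)
  let ?e = "Poly_Mapping.single k (1::nat)"
  have "Poly_Mapping.lookup (taylor_coeff G ?e) (i - ?e) =
      (\<Sum>j\<in>Poly_Mapping.keys G. Poly_Mapping.lookup G j * (of_nat (Poly_Mapping.lookup j k) when j - ?e = i - ?e))"
    unfolding taylor_coeff_eq lookup_taylor_monom_1
    by (simp add: lookup_sum lookup_const_mult lookup_single)
  also have "\<dots> = (\<Sum>j\<in>Poly_Mapping.keys G. if j = i then Poly_Mapping.lookup G i * of_nat (Poly_Mapping.lookup i k) else 0)"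
  proof (intro sum.cong refl)
    fix j
    have "j = i" if "j - ?e = i - ?e" "Poly_Mapping.lookup j k \<noteq> 0"
    proof (rule poly_mapping_eqI)
      fix m
      have "Poly_Mapping.lookup (j - ?e) m = Poly_Mapping.lookup (i - ?e) m" using that by simp
      then show "Poly_Mapping.lookup j m = Poly_Mapping.lookup i m"
        using that k by (auto simp: lookup_minus lookup_single when_def in_keys_iff split: if_splits)
    qed
    then show "Poly_Mapping.lookup G j * (of_nat (Poly_Mapping.lookup j k) when j - ?e = i - ?e) =
        (if j = i then Poly_Mapping.lookup G i * of_nat (Poly_Mapping.lookup i k) else 0)"
      by (cases "Poly_Mapping.lookup j k = 0") (auto simp: when_def)
  qed
  also have "\<dots> = Poly_Mapping.lookup G i * of_nat (Poly_Mapping.lookup i k)"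
    using i by simp
  also have "\<dots> \<noteq> 0"
    using i k assms(1) by (simp add: in_keys_iff of_nat_eq_0_iff_char_dvd)
  finally have "taylor_coeff G ?e \<noteq> 0" by auto
  moreover have "k \<le> n"
    using i k assms(2) by (auto simp: order_le_def multi_indices_def)
  ultimately show ?thesis using that by blast
qed

lemma sigma_weight_single: "sigma_weight v \<sigma> (Poly_Mapping.single k 1) \<gamma> = (induced_vg v \<sigma> ^^ k) \<gamma>"
  by (simp add: sigma_weight_def)

context valued_difference_field
begin

lemma char_eq_0:
  assumes "CHAR('r) = 0"
  shows "CHAR('k) = 0"
proof -
  have one: "1 \<in> valuation_ring v" using mem_valuation_ring[of 1] v_mult[of 1 1] by simp
  have add: "x + y \<in> valuation_ring v" if "x \<in> valuation_ring v" "y \<in> valuation_ring v" for x y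
    using valuation_ring_diff[OF that(1) valuation_ring_minus[OF that(2)]] by simp
  have zero: "0 \<in> valuation_ring v" using valuation_ring_diff[OF one one] by simp
  have "of_nat m \<in> valuation_ring v \<and> \<pi> (of_nat m) = of_nat m" for m
  proof (induction m)
    case 0
    show ?case using zero res_diff[OF one one] by simp
  next
    case (Suc m)
    then show ?case using add[OF one, of "of_nat m"] res_add[OF one, of "of_nat m"] res_one by simp
  qed
  then have "of_nat m = (0 :: 'k) \<Longrightarrow> of_nat m = (0 :: 'r)" for m
    by (metis of_nat_0)
  then show ?thesis
    using assms by (simp only: CHAR_eq0_iff) blast
qed

lemma hensel_witness_eval_nonzero:
  assumes "CHAR('r) = 0" and "order_le n G" and "hensel_config v \<sigma> n G a"
    and w: "hensel_witness v \<sigma> n G a i \<gamma>"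
  shows "sigma_eval \<sigma> G a \<noteq> 0"
proof
  assume 0: "sigma_eval \<sigma> G a = 0"
  obtain k where k: "k \<le> n" "taylor_coeff G (Poly_Mapping.single k 1) \<noteq> 0"
    using exists_taylor_coeff_1_nonzero[OF char_eq_0[OF assms(1)] assms(2)] assms(3)
    unfolding hensel_config_def by blast
  let ?e = "Poly_Mapping.single k (1::nat)"
  have e: "?e \<in> multi_indices n" "weight ?e = 1" "?e \<noteq> 0"
    using k by (auto simp: multi_indices_def weight_def poly_mapping_eq_iff fun_eq_iff lookup_single when_def)
  let ?X = "\<lambda>j. val v (sigma_eval \<sigma> (taylor_coeff G j) a) + Fin (sigma_weight v \<sigma> j \<gamma>)"
  have "?X i = Pinf"
    using w 0 by (simp add: hensel_witness_def val_def)
  moreover have "?X i \<le> ?X ?e"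
    using w e(1,2) unfolding hensel_witness_def by blast
  moreover have "?X ?e < ?X (?e + ?e)"
    using w e(1,3) k(2) unfolding hensel_witness_def by blast
  ultimately show False by simp
qed

lemma hensel_witness_le:
  assumes "sigma_eval \<sigma> G a \<noteq> 0" and "hensel_witness v \<sigma> n G a i \<gamma>"
    and "hensel_witness v \<sigma> n G a j \<delta>" and "j \<in> multi_indices n" "weight j = 1"
  shows "\<delta> \<le> \<gamma>"
proof -
  obtain k where j: "j = Poly_Mapping.single k 1" using assms(5) weight_eq_1_iff by blast
  have "strict_mono (induced_vg v \<sigma> ^^ k)"
    using induced_vg_strict_mono by (induction k) (auto simp: strict_mono_def)
  moreover have "(induced_vg v \<sigma> ^^ k) \<delta> \<le> (induced_vg v \<sigma> ^^ k) \<gamma>"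
  proof -
    obtain h where h: "val v (sigma_eval \<sigma> (taylor_coeff G j) a) = Fin h"
      using assms(1,3) by (auto simp: hensel_witness_def val_def split: if_splits)
    have "val v (sigma_eval \<sigma> G a) = Fin (h + sigma_weight v \<sigma> j \<delta>)"
      using assms(3) h by (simp add: hensel_witness_def)
    moreover have "val v (sigma_eval \<sigma> G a) \<le> Fin (h + sigma_weight v \<sigma> j \<gamma>)"
      using assms(2,4,5) h unfolding hensel_witness_def by (metis plus_extended.simps(1))
    ultimately show ?thesis
      by (simp add: j sigma_weight_single del: One_nat_def)
  qed
  ultimately show ?thesis by (simp add: strict_mono_less_eq)
qed

lemma hensel_gamma_eq:
  assumes "CHAR('r) = 0" and "order_le n G" and "\<And>c. G \<noteq> Poly_Mapping.single 0 c"
    and "i \<in> multi_indices n" "weight i = 1" "hensel_witness v \<sigma> n G a i \<gamma>"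
  shows "hensel_gamma v \<sigma> n G a = \<gamma>"
proof -
  have "hensel_config v \<sigma> n G a"
    using assms unfolding hensel_config_def by blast
  then have nz: "sigma_eval \<sigma> G a \<noteq> 0"
    using hensel_witness_eval_nonzero assms by blast
  show ?thesis
    unfolding hensel_gamma_def
    by (rule the_equality) (use assms nz hensel_witness_le in \<open>blast intro: order_antisym\<close>)+
qed

end

end

theory Submission
  imports Defs
begin

text \<open>
  The equation over the residue field is the reduction of an affine \<open>\<sigma>\<close>-polynomial over \<open>K\<close>, and
  such a polynomial is its own Taylor expansion. Lift each \<open>\<alpha>\<^sub>k\<close> to an element \<open>a\<^sub>k\<close> of the
  valuation ring and put \<open>G(x) = 1 + \<Sum>\<^sub>k a\<^sub>k \<sigma>\<^sup>k(x)\<close>. At the point \<open>0\<close> the Taylor coefficient of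
  \<open>G\<close> at the index of \<open>\<sigma>\<^sup>k(x)\<close> is the constant \<open>a\<^sub>k\<close>, and those of weight at least two vanish
  (\<open>taylor_coeff_affine\<close>). Hence condition (ii) of a \<open>\<sigma>\<close>-hensel configuration only compares a finite
  value with \<open>\<infinity>\<close>, and condition (i) for \<open>\<gamma> = 0\<close> says that some \<open>a\<^sub>k\<close> has the least possible
  value, that of \<open>G(0) = 1\<close>. It holds because some \<open>\<alpha>\<^sub>k\<close> is nonzero, that is, some \<open>a\<^sub>k\<close> is a
  unit (\<open>hensel_witness_affine\<close>).

  So \<open>(G, 0)\<close> is in \<open>\<sigma>\<close>-hensel configuration with \<open>\<gamma>(G, 0) = 0\<close>, and \<open>\<sigma>\<close>-henselianity gives a
  root \<open>b\<close> of \<open>G\<close> with \<open>v(b) = 0\<close>. In particular \<open>b\<close> is integral, and since the residue map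
  commutes with sums, products and \<open>\<sigma>\<close>, its residue solves the given equation. The residue
  characteristic enters through the uniqueness of \<open>\<gamma>(G, 0)\<close>.
\<close>

section \<open>Evaluation and Taylor coefficients of affine difference polynomials\<close>

lemma sigma_eval_add: "sigma_eval \<sigma> (G + H) x = sigma_eval \<sigma> G x + sigma_eval \<sigma> H x"
  unfolding sigma_eval_def
  by (rule setsum_keys_plus_distrib) (simp_all add: distrib_right)

lemma sigma_eval_single: "sigma_eval \<sigma> (Poly_Mapping.single i c) x = c * sigma_monom \<sigma> i x"
  by (simp add: sigma_eval_def)

lemma sigma_eval_sum: "sigma_eval \<sigma> (\<Sum>k\<in>A. G k) x = (\<Sum>k\<in>A. sigma_eval \<sigma> (G k) x)"
  by (induction A rule: infinite_finite_induct) (simp_all add: sigma_eval_add sigma_eval_def[of _ 0])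

lemma taylor_coeff_add: "taylor_coeff (G + H) i = taylor_coeff G i + taylor_coeff H i"
  unfolding taylor_coeff_eq
  by (rule setsum_keys_plus_distrib) (simp_all add: distrib_right single_add)

lemma taylor_coeff_single:
  "taylor_coeff (Poly_Mapping.single j c) i =
     Poly_Mapping.single 0 c * Poly_Mapping.lookup (taylor_monom j) i"
  by (simp add: taylor_coeff_eq)

lemma taylor_coeff_sum: "taylor_coeff (\<Sum>k\<in>A. G k) i = (\<Sum>k\<in>A. taylor_coeff (G k) i)"
  by (induction A rule: infinite_finite_induct) (simp_all add: taylor_coeff_add taylor_coeff_eq[of 0])

definition affine_sigma_poly :: "'k::field \<Rightarrow> (nat \<Rightarrow> 'k) \<Rightarrow> nat \<Rightarrow> 'k sigma_poly" where
  "affine_sigma_poly c a n =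
     Poly_Mapping.single 0 c + (\<Sum>k\<le>n. Poly_Mapping.single (Poly_Mapping.single k 1) (a k))"

lemma lookup_affine_single:
  assumes "k \<le> n"
  shows "Poly_Mapping.lookup (affine_sigma_poly c a n) (Poly_Mapping.single k 1) = a k"
proof -
  have "Poly_Mapping.single m (1::nat) = Poly_Mapping.single k 1 \<longleftrightarrow> m = k" for m
    by (metis lookup_single_eq lookup_single_not_eq one_neq_zero)
  moreover have "(0 :: multi_index) \<noteq> Poly_Mapping.single k 1"
    using single_ne_0[of 0 k] by simp
  ultimately show ?thesis
    using assms by (simp add: affine_sigma_poly_def lookup_add lookup_sum lookup_single when_def
        del: One_nat_def)
qed

lemma affine_neq_constant:
  assumes "k \<le> n" and "a k \<noteq> 0"
  shows "affine_sigma_poly c a n \<noteq> Poly_Mapping.single 0 d"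
proof
  assume "affine_sigma_poly c a n = Poly_Mapping.single 0 d"
  then have "a k = Poly_Mapping.lookup (Poly_Mapping.single 0 d) (Poly_Mapping.single k (1::nat))"
    using lookup_affine_single[OF assms(1), of c a] by simp
  also have "\<dots> = 0"
    using single_ne_0[of 0 k] by (simp add: lookup_single when_def del: One_nat_def)
  finally show False using assms(2) by simp
qed

lemma order_le_affine: "order_le n (affine_sigma_poly c a n)"
proof -
  have "Poly_Mapping.keys (\<Sum>k\<le>m. Poly_Mapping.single (Poly_Mapping.single k (1::nat)) (a k))
      \<subseteq> multi_indices n" if "m \<le> n" for m
    using that
  proof (induction m)
    case (Suc m)
    then show ?case
      using keys_add[of "\<Sum>k\<le>m. Poly_Mapping.single (Poly_Mapping.single k (1::nat)) (a k)"
          "Poly_Mapping.single (Poly_Mapping.single (Suc m) (1::nat)) (a (Suc m))"]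
      by (fastforce simp: multi_indices_def split: if_splits)
  qed (auto simp: multi_indices_def)
  then show ?thesis
    unfolding order_le_def affine_sigma_poly_def
    using keys_add[of "Poly_Mapping.single 0 c"
        "\<Sum>k\<le>n. Poly_Mapping.single (Poly_Mapping.single k (1::nat)) (a k)"]
    by (fastforce simp: multi_indices_def split: if_splits)
qed

lemma sigma_eval_affine:
  "sigma_eval \<sigma> (affine_sigma_poly c a n) x = c + (\<Sum>k\<le>n. a k * (\<sigma> ^^ k) x)"
  by (simp add: affine_sigma_poly_def sigma_eval_add sigma_eval_sum sigma_eval_single sigma_monom_def)

text \<open>The expansion of \<open>\<sigma>\<^sup>k(a + x) = \<sigma>\<^sup>k(a) + \<sigma>\<^sup>k(x)\<close> away from its constant term \<open>\<sigma>\<^sup>k(a)\<close>.\<close>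

lemma lookup_taylor_monom_single:
  assumes "j \<noteq> 0"
  shows "Poly_Mapping.lookup (taylor_monom (Poly_Mapping.single k 1)) j =
           (1 when j = Poly_Mapping.single k 1)"
  using assms by (auto simp: taylor_monom_def taylor_var_def lookup_add lookup_single when_def)

lemma taylor_coeff_affine:
  fixes a :: "nat \<Rightarrow> 'a::field"
  assumes "j \<noteq> 0"
  shows "taylor_coeff (affine_sigma_poly c a n) j =
           (\<Sum>k\<le>n. Poly_Mapping.single 0 (a k) when j = Poly_Mapping.single k 1)"
proof -
  have "Poly_Mapping.lookup (taylor_monom 0 :: multi_index \<Rightarrow>\<^sub>0 'a sigma_poly) j = 0"
    using assms by (simp add: taylor_monom_def lookup_one)
  moreover have "Poly_Mapping.single 0 (a k) *
      Poly_Mapping.lookup (taylor_monom (Poly_Mapping.single k 1)) j =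
      (Poly_Mapping.single 0 (a k) when j = Poly_Mapping.single k 1)" for k
    unfolding lookup_taylor_monom_single[OF assms] by (simp add: when_def)
  ultimately show ?thesis
    by (simp add: affine_sigma_poly_def taylor_coeff_add taylor_coeff_sum taylor_coeff_single
        del: One_nat_def)
qed

lemma taylor_coeff_affine_single:
  assumes "k \<le> n"
  shows "taylor_coeff (affine_sigma_poly c a n) (Poly_Mapping.single k 1) = Poly_Mapping.single 0 (a k)"
proof -
  have "Poly_Mapping.single k (1::nat) = Poly_Mapping.single m 1 \<longleftrightarrow> m = k" for m
    by (metis lookup_single_eq lookup_single_not_eq one_neq_zero)
  moreover have "Poly_Mapping.single k (1::nat) \<noteq> 0"
    using single_ne_0[of 0 k] by (metis add_0)
  ultimately show ?thesis
    using assms by (simp add: taylor_coeff_affine when_def del: One_nat_def)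
qed

lemma taylor_coeff_affine_eq_0:
  assumes "j \<noteq> 0" and "\<And>k. k \<le> n \<Longrightarrow> j \<noteq> Poly_Mapping.single k 1"
  shows "taylor_coeff (affine_sigma_poly c a n) j = 0"
  using assms by (simp add: taylor_coeff_affine when_def del: One_nat_def)

text \<open>
  An index \<open>j + l\<close> with both summands nonzero has weight at least two, so the Taylor coefficient of
  an affine \<open>\<sigma>\<close>-polynomial vanishes there.
\<close>

lemma single_neq_add:
  fixes j l :: multi_index
  assumes "j \<noteq> 0" and "l \<noteq> 0"
  shows "j + l \<noteq> Poly_Mapping.single k 1"
proof
  assume eq: "j + l = Poly_Mapping.single k 1"
  have sum: "Poly_Mapping.lookup j m + Poly_Mapping.lookup l m = (1 when k = m)" for m
    unfolding lookup_add[symmetric] eq lookup_single ..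
  have "Poly_Mapping.lookup i k \<noteq> 0" if "i \<noteq> 0" "i = j \<or> i = l" for i
  proof
    assume "Poly_Mapping.lookup i k = 0"
    then have "Poly_Mapping.lookup i m = 0" for m
      using sum[of m] that(2) by (cases "m = k") auto
    then show False using that(1) by (simp add: poly_mapping_eqI)
  qed
  from this[of j] this[of l] show False
    using sum[of k] assms by (simp add: when_def)
qed

section \<open>The residue map and the valuation ring\<close>

context valued_difference_field
begin

lemma v_one: "v 1 = 0"
  using v_mult[of 1 1] by simp

lemma aut_one: "\<sigma> 1 = 1"
  using aut_mult[of 1 1] aut_eq_0_iff[of 1] by simp

lemma sigma_weight_zero: "sigma_weight v \<sigma> i 0 = 0"
proof -
  have "induced_vg v \<sigma> 0 = 0"
    using induced_vg_v[of 1] by (simp add: v_one aut_one)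
  then have "(induced_vg v \<sigma> ^^ k) 0 = 0" for k
    by (induction k) simp_all
  then show ?thesis by (simp add: sigma_weight_def)
qed

lemma valuation_ring_zero: "0 \<in> valuation_ring v"
  by (simp add: valuation_ring_def val_def zero_extended_def)

lemma valuation_ring_add:
  "x \<in> valuation_ring v \<Longrightarrow> y \<in> valuation_ring v \<Longrightarrow> x + y \<in> valuation_ring v"
  using valuation_ring_diff[of x "- y"] valuation_ring_minus[of y] by simp

lemma valuation_ring_mult:
  "x \<in> valuation_ring v \<Longrightarrow> y \<in> valuation_ring v \<Longrightarrow> x * y \<in> valuation_ring v"
  by (cases "x = 0 \<or> y = 0") (auto simp: valuation_ring_zero mem_valuation_ring v_mult)

lemma res_zero: "\<pi> 0 = 0"
  using res_diff[OF valuation_ring_zero valuation_ring_zero] by simp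

lemma res_sum:
  assumes "\<And>k. k \<in> A \<Longrightarrow> f k \<in> valuation_ring v"
  shows "(\<Sum>k\<in>A. f k) \<in> valuation_ring v \<and> \<pi> (\<Sum>k\<in>A. f k) = (\<Sum>k\<in>A. \<pi> (f k))"
  using assms
  by (induction A rule: infinite_finite_induct)
    (simp_all add: valuation_ring_zero res_zero valuation_ring_add res_add)

lemma res_aut_funpow:
  assumes "x \<in> valuation_ring v"
  shows "(\<sigma> ^^ k) x \<in> valuation_ring v \<and> \<pi> ((\<sigma> ^^ k) x) = (induced_res v \<pi> \<sigma> ^^ k) (\<pi> x)"
  using assms by (induction k) (simp_all add: aut_mem_iff induced_res_res[symmetric])

lemma res_sigma_eval_affine:
  assumes "\<And>k. k \<le> n \<Longrightarrow> a k \<in> valuation_ring v" and "x \<in> valuation_ring v"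
  shows "\<pi> (sigma_eval \<sigma> (affine_sigma_poly 1 a n) x) =
           1 + (\<Sum>k\<le>n. \<pi> (a k) * (induced_res v \<pi> \<sigma> ^^ k) (\<pi> x))"
proof -
  have "1 \<in> valuation_ring v"
    by (simp add: mem_valuation_ring v_one)
  moreover have "a k * (\<sigma> ^^ k) x \<in> valuation_ring v" if "k \<in> {..n}" for k
    using that assms res_aut_funpow valuation_ring_mult by simp
  ultimately show ?thesis
    using assms res_sum[of "{..n}" "\<lambda>k. a k * (\<sigma> ^^ k) x"]
    by (simp add: sigma_eval_affine res_add res_one res_mult res_aut_funpow)
qed

section \<open>The hensel configuration and the linear equation\<close>

text \<open>
  For \<open>\<gamma> = 0\<close> the weights \<open>\<sigma>\<^sup>j(\<gamma>)\<close> all vanish and the two conditions compare values of the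
  coefficients alone: these are nonnegative, the unit \<open>a\<^sub>k\<close> attains the value \<open>0\<close> of the constant
  term, and every Taylor coefficient of higher weight has value \<open>\<infinity>\<close>. An \<open>a\<^sub>m\<close> that is zero does
  no harm, as condition (ii) is only required at nonzero Taylor coefficients.
\<close>

lemma hensel_witness_affine:
  assumes a: "\<And>m. m \<le> n \<Longrightarrow> a m \<in> valuation_ring v"
    and k: "k \<le> n" and unit: "\<pi> (a k) \<noteq> 0"
  shows "hensel_witness v \<sigma> n (affine_sigma_poly 1 a n) 0 (Poly_Mapping.single k 1) 0"
proof -
  let ?G = "affine_sigma_poly 1 a n"
  let ?X = "\<lambda>j. val v (sigma_eval \<sigma> (taylor_coeff ?G j) 0) + Fin (sigma_weight v \<sigma> j 0)"
  have funpow0: "(\<sigma> ^^ m) 0 = 0" for m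
    by (induction m) simp_all
  have X_zero: "?X j = Pinf" if "taylor_coeff ?G j = 0" for j
    using that by (simp add: sigma_eval_def val_def)
  have X_single: "?X (Poly_Mapping.single m 1) = val v (a m)" if "m \<le> n" for m
    using that by (simp add: taylor_coeff_affine_single sigma_eval_single sigma_monom_def
        sigma_weight_zero val_def del: One_nat_def)
  \<comment> \<open>An integral element with nonzero residue lies outside the maximal ideal, so its value is \<open>0\<close>.\<close>
  have X_unit: "?X (Poly_Mapping.single k 1) = 0"
    unfolding X_single[OF k]
    using a[OF k] unit res_ker[OF a[OF k]] by (auto simp: valuation_ring_def)
  have "val v (sigma_eval \<sigma> ?G 0) = 0"
    by (simp add: sigma_eval_affine funpow0 val_def v_one zero_extended_def)
  moreover have "0 \<le> ?X j" if j: "j \<in> multi_indices n" "weight j = 1" for j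
  proof -
    obtain m where m: "j = Poly_Mapping.single m 1"
      using j(2) weight_eq_1_iff by blast
    then have "m \<le> n"
      using j(1) by (simp add: multi_indices_def)
    then show ?thesis
      unfolding m X_single[OF \<open>m \<le> n\<close>] using a by (simp add: valuation_ring_def)
  qed
  moreover have "?X j < ?X (j + l)"
    if jl: "j \<noteq> 0" "l \<noteq> 0" "taylor_coeff ?G j \<noteq> 0" for j l
  proof -
    obtain m where m: "m \<le> n" "j = Poly_Mapping.single m 1"
      using jl taylor_coeff_affine_eq_0 by blast
    have "a m \<noteq> 0"
      using jl(3) unfolding m(2) taylor_coeff_affine_single[OF m(1)] by auto
    then have "?X j < Pinf"
      unfolding m(2) X_single[OF m(1)] by (simp add: val_def)
    moreover have "j + l \<noteq> 0"
      using jl(1) by (metis add_eq_0_iff_both_eq_0 lookup_add lookup_zero poly_mapping_eqI)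
    then have "?X (j + l) = Pinf"
      using single_neq_add[OF jl(1,2)] by (intro X_zero taylor_coeff_affine_eq_0)
    ultimately show ?thesis by simp
  qed
  ultimately show ?thesis
    unfolding hensel_witness_def X_unit by blast
qed

end

theorem lemma4p6:
  fixes v :: "'k::field \<Rightarrow> 'g::linordered_ab_group_add"
    and \<pi> :: "'k \<Rightarrow> 'r::field"
    and \<sigma> :: "'k \<Rightarrow> 'k"
  assumes "valued_difference_field v \<pi> \<sigma>"
    and "CHAR('r) = 0"
    and "sigma_henselian v \<sigma>"
  shows "\<forall>(n::nat) (\<alpha>::nat \<Rightarrow> 'r). (\<exists>k\<le>n. \<alpha> k \<noteq> 0) \<longrightarrow>
           (\<exists>x. 1 + (\<Sum>k\<le>n. \<alpha> k * (induced_res v \<pi> \<sigma> ^^ k) x) = 0)"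
proof (intro allI impI)
  fix n :: nat and \<alpha> :: "nat \<Rightarrow> 'r"
  interpret valued_difference_field v \<pi> \<sigma> by (fact assms(1))
  assume "\<exists>k\<le>n. \<alpha> k \<noteq> 0"
  then obtain k where k: "k \<le> n" "\<alpha> k \<noteq> 0" by blast
  have "\<exists>x. x \<in> valuation_ring v \<and> \<pi> x = \<alpha> m" for m
    using res_surj by (metis UNIV_I imageE)
  then obtain a where a: "a m \<in> valuation_ring v" "\<pi> (a m) = \<alpha> m" for m
    by metis
  let ?G = "affine_sigma_poly 1 a n" and ?e = "Poly_Mapping.single k (1::nat)"
  have "a k \<noteq> 0"
    using k(2) a(2)[of k] res_zero by auto
  then have nonconst: "?G \<noteq> Poly_Mapping.single 0 c" for c
    using affine_neq_constant k(1) by blast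
  have e: "?e \<in> multi_indices n" "weight ?e = 1"
    using k(1) by (auto simp: multi_indices_def weight_def)
  have witness: "hensel_witness v \<sigma> n ?G 0 ?e 0"
    using a k by (intro hensel_witness_affine) simp_all
  then have "hensel_config v \<sigma> n ?G 0"
    using nonconst e unfolding hensel_config_def by blast
  then obtain b where b: "val v (b - 0) = Fin (hensel_gamma v \<sigma> n ?G 0)" "sigma_eval \<sigma> ?G b = 0"
    using assms(3) order_le_affine unfolding sigma_henselian_def by blast
  have "hensel_gamma v \<sigma> n ?G 0 = 0"
    by (rule hensel_gamma_eq[OF assms(2) order_le_affine nonconst e witness])
  \<comment> \<open>It matters that the root has value \<open>0\<close>: only an integral root has a residue.\<close>
  then have "b \<in> valuation_ring v"
    using b(1) by (simp add: valuation_ring_def zero_extended_def)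
  then have "1 + (\<Sum>m\<le>n. \<alpha> m * (induced_res v \<pi> \<sigma> ^^ m) (\<pi> b)) = 0"
    using res_sigma_eval_affine[of n a b] a b(2) res_zero by simp
  then show "\<exists>x. 1 + (\<Sum>m\<le>n. \<alpha> m * (induced_res v \<pi> \<sigma> ^^ m) x) = 0" ..
qed

end
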